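(* Let $0<\mu\le L$ and $f\in\mathcal S^1_{\mu,L}$. Let $s>0$, $q=\mu s$, and let $\eta,\nu,\tau$ be real numbers such that $0\le\eta s\le1/L$, $\nu\ge0$, $1-\nu\sqrt q>0$, $\tau>0$ and $\zeta:=1+(1-\tau)\sqrt q\ge0$. Define $$\mathbf I=\zeta\nu(\tau+\zeta\eta\sqrt q)-\tau^2,\qquad\mathbf{II}=\tau(\nu\tau-2\zeta\eta)+\zeta\eta(\nu\tau-\zeta\eta)\sqrt q,$$ and, for the iterates of algorithm $(\mathcal A)$ (defined in the context) and $k\ge0$, $$V_{k+1}=\frac{\zeta\nu}{\tau^2}(\tau+\zeta\eta\sqrt q)\Big(f(x_k)-f^*-\frac{\eta s}{2}\|\nabla f(x_k)\|^2\Big)+\frac\mu2\|z_{k+1}-x^*\|^2.$$ If one of the following (mutually exclusive) conditions holds: (i) $\mathbf I>0$ and $\mathbf I+\sqrt q\,\mathbf{II}\le0$; (ii) $\mathbf{II}>0$ and $\frac\mu L\mathbf I+\sqrt q\,\mathbf{II}\le0$; (iii) $\mathbf I\le0$ and $\mathbf{II}\le0$; then $V_{k+1}\le(1-\nu\sqrt q)V_k$ for all $k\ge1$.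
   Context: For $0<\mu\le L$, $\mathcal S^1_{\mu,L}$ is the set of continuously differentiable convex functions $f:\mathbb R^n\to\mathbb R$ that are $L$-smooth ($\|\nabla f(y)-\nabla f(x)\|\le L\|y-x\|$ for all $x,y$) and $\mu$-strongly convex ($f(y)\ge f(x)+\langle\nabla f(x),y-x\rangle+\frac{\mu}{2}\|y-x\|^2$ for all $x,y$); $\|\cdot\|$ is the Euclidean norm. $x^*$ is the unique minimizer of $f$ and $f^*=f(x^* )$. Algorithm $(\mathcal A)$ with parameters $\eta,\nu,\tau\ge0$: starting from $x_0=z_0\in\mathbb R^n$, for $k\ge0$, $$y_{k+1}=x_k-\eta s\nabla f(x_k),$$ $$z_{k+1}=\nu\sqrt q\,\Big(x_k-\frac1\mu\nabla f(x_k)\Big)+(1-\nu\sqrt q)z_k,$$ $$x_{k+1}=\frac{\tau\sqrt q}{1+\sqrt q}z_{k+1}+\Big(1-\frac{\tau\sqrt q}{1+\sqrt q}\Big)y_{k+1}.$$ *)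

theory Defs
  imports "HOL-Analysis.Analysis"
begin

(* Meaningful only where f is differentiable; the class below requires this everywhere. *)
definition grad :: "(real ^ 'n \<Rightarrow> real) \<Rightarrow> real ^ 'n \<Rightarrow> real ^ 'n" where
  "grad f x = (THE g. GDERIV f x :> g)"

definition smooth_strongly_convex :: "real \<Rightarrow> real \<Rightarrow> (real ^ 'n \<Rightarrow> real) set" where
  "smooth_strongly_convex \<mu> L = {f.
     f differentiable_on UNIV \<and> continuous_on UNIV (grad f) \<and>
     convex_on UNIV f \<and>
     (\<forall>x y. norm (grad f y - grad f x) \<le> L * norm (y - x)) \<and>
     (\<forall>x y. f y \<ge> f x + grad f x \<bullet> (y - x) + \<mu> / 2 * (norm (y - x))\<^sup>2)}"

definition minimizer :: "(real ^ 'n \<Rightarrow> real) \<Rightarrow> real ^ 'n" where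
  "minimizer f = (THE x. \<forall>y. f x \<le> f y)"

(* The term y 0 is unused and left unconstrained. *)
definition algorithm_iterates ::
  "(real ^ 'n \<Rightarrow> real) \<Rightarrow> real \<Rightarrow> real \<Rightarrow> real \<Rightarrow> real \<Rightarrow> real \<Rightarrow>
   (nat \<Rightarrow> real ^ 'n) \<Rightarrow> (nat \<Rightarrow> real ^ 'n) \<Rightarrow> (nat \<Rightarrow> real ^ 'n) \<Rightarrow> bool" where
  "algorithm_iterates f \<mu> s \<eta> \<nu> \<tau> x y z \<longleftrightarrow>
     (let q = \<mu> * s in
       x 0 = z 0 \<and>
       (\<forall>k. y (k + 1) = x k - (\<eta> * s) *\<^sub>R grad f (x k) \<and>
            z (k + 1) = (\<nu> * sqrt q) *\<^sub>R (x k - (1 / \<mu>) *\<^sub>R grad f (x k))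
                        + (1 - \<nu> * sqrt q) *\<^sub>R z k \<and>
            x (k + 1) = (\<tau> * sqrt q / (1 + sqrt q)) *\<^sub>R z (k + 1)
                        + (1 - \<tau> * sqrt q / (1 + sqrt q)) *\<^sub>R y (k + 1)))"

(* The three alternative parameter conditions exclude one another for arbitrary reals I and II. *)
lemma conditions_mutually_exclusive:
  fixes \<mu> L q I II :: real
  assumes "0 < \<mu>" and "\<mu> \<le> L" and "0 < q"
  defines "c1 \<equiv> I > 0 \<and> I + sqrt q * II \<le> 0"
    and "c2 \<equiv> II > 0 \<and> \<mu> / L * I + sqrt q * II \<le> 0"
    and "c3 \<equiv> I \<le> 0 \<and> II \<le> 0"
  shows "\<not> (c1 \<and> c2) \<and> \<not> (c1 \<and> c3) \<and> \<not> (c2 \<and> c3)"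
proof -
  have False if "I > 0" "II > 0" "I + sqrt q * II \<le> 0"
  proof -
    have "sqrt q * II > 0" using that assms(3) by simp
    then show False using that by linarith
  qed
  then show ?thesis unfolding c1_def c2_def c3_def by force
qed

end

theory Submission
  imports Defs
begin

text \<open>
  Put \<open>a = \<eta> s\<close>, \<open>g = \<nabla>f(x\<^sub>k)\<close>, \<open>d = y\<^sub>k - x\<^sub>k\<close> and \<open>p = \<nu> \<surd>q\<close>. The update of \<open>x\<close> says
  \<open>z\<^sub>k = x\<^sub>k - \<zeta> / (\<tau> \<surd>q) d\<close>, so \<open>V\<^bsub>k+1\<^esub> - (1 - p) V\<^sub>k\<close> becomes an expression in the function
  values and the inner products of \<open>g\<close>, \<open>d\<close> and \<open>x\<^sub>k - x\<^sup>*\<close>. It equals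
  \<open>p / \<tau>\<^sup>2 (I (f(x\<^sub>k) - f\<^sup>*) + \<surd>q II \<parallel>g\<parallel>\<^sup>2 / (2 \<mu>))\<close> minus nonnegative multiples of three
  nonnegative quantities: the slack in the cocoercivity inequality between \<open>x\<^bsub>k-1\<^esub>\<close> and \<open>x\<^sub>k\<close>
  (weakened by \<open>a \<le> 1 / L\<close>), the slack in strong convexity between \<open>x\<^sub>k\<close> and \<open>x\<^sup>*\<close>, and
  \<open>\<parallel>d + a g\<parallel>\<^sup>2\<close>. The sign of the remaining expression follows in the three cases from
  \<open>\<parallel>g\<parallel>\<^sup>2 / (2 L) \<le> f(x\<^sub>k) - f\<^sup>* \<le> \<parallel>g\<parallel>\<^sup>2 / (2 \<mu>)\<close>.
\<close>

lemma GDERIV_grad: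
  fixes f :: "real ^ 'n \<Rightarrow> real"
  assumes "f differentiable (at x)"
  shows "GDERIV f x :> grad f x"
proof -
  obtain D where D: "(f has_derivative D) (at x)"
    using assms by (auto simp: differentiable_def)
  have "linear D" using D has_derivative_linear by blast
  then have "D = (\<lambda>h. h \<bullet> adjoint D 1)"
    by (simp add: adjoint_works fun_eq_iff)
  then have 1: "GDERIV f x :> adjoint D 1"
    using D by (simp add: gderiv_def)
  moreover have "g = adjoint D 1" if "GDERIV f x :> g" for g
  proof -
    have "(\<lambda>h. h \<bullet> g) = (\<lambda>h. h \<bullet> adjoint D 1)"
      using that 1 unfolding gderiv_def by (rule has_derivative_unique)
    then show ?thesis
      by (simp add: fun_eq_iff vector_eq_ldot)
  qed
  ultimately show ?thesis
    unfolding grad_def by (rule theI)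
qed

lemma GDERIV_global_min:
  assumes "GDERIV f x :> g" and "\<And>y. f x \<le> f y"
  shows "g = 0"
proof -
  have "(\<lambda>h. h \<bullet> g) = (\<lambda>h. 0)"
    using assms unfolding gderiv_def
    by (intro differential_zero_maxmin[of x UNIV f]) auto
  then show ?thesis
    by (metis inner_eq_zero_iff)
qed

lemma smooth_upper_bound:
  fixes f :: "'a::real_inner \<Rightarrow> real"
  assumes der: "\<And>x. GDERIV f x :> G x"
    and lip: "\<And>x y. norm (G y - G x) \<le> L * norm (y - x)"
  shows "f y \<le> f x + G x \<bullet> (y - x) + L / 2 * (norm (y - x))\<^sup>2"
proof -
  define d where "d = y - x"
  define \<phi> where "\<phi> t = f (x + t *\<^sub>R d) - t * (G x \<bullet> d) - L / 2 * t\<^sup>2 * (norm d)\<^sup>2" for t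
  have "\<phi> 1 \<le> \<phi> 0"
  proof (rule DERIV_nonpos_imp_nonincreasing[of 0 1 \<phi>])
    fix t :: real
    assume t: "0 \<le> t" "t \<le> 1"
    have "((\<lambda>t. f (x + t *\<^sub>R d)) has_derivative (\<lambda>h. (h *\<^sub>R d) \<bullet> G (x + t *\<^sub>R d))) (at t)"
      using der unfolding gderiv_def
      by (intro has_derivative_compose[of "\<lambda>t. x + t *\<^sub>R d" "\<lambda>h. h *\<^sub>R d" t UNIV f])
        (auto intro!: derivative_eq_intros)
    then have 1: "((\<lambda>t. f (x + t *\<^sub>R d)) has_real_derivative G (x + t *\<^sub>R d) \<bullet> d) (at t)"
      by (simp add: has_field_derivative_def inner_commute mult_commute_abs)
    have "(\<phi> has_real_derivative G (x + t *\<^sub>R d) \<bullet> d - G x \<bullet> d - L * t * (norm d)\<^sup>2) (at t)"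
      unfolding \<phi>_def by (rule derivative_eq_intros 1 refl | simp)+
    moreover have "(G (x + t *\<^sub>R d) - G x) \<bullet> d \<le> L * t * (norm d)\<^sup>2"
    proof -
      have "(G (x + t *\<^sub>R d) - G x) \<bullet> d \<le> norm (G (x + t *\<^sub>R d) - G x) * norm d"
        by (rule norm_cauchy_schwarz)
      also have "\<dots> \<le> (L * norm (t *\<^sub>R d)) * norm d"
        using lip[of "x + t *\<^sub>R d" x] by (intro mult_right_mono) auto
      finally show ?thesis
        using t by (simp add: power2_eq_square mult_ac)
    qed
    ultimately show "\<exists>D. (\<phi> has_real_derivative D) (at t) \<and> D \<le> 0"
      by (metis diff_le_0_iff_le inner_diff_left)
  qed auto
  then show ?thesis
    by (simp add: \<phi>_def d_def)
qed

lemma cocoercive: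
  fixes f :: "'a::real_inner \<Rightarrow> real"
  assumes der: "\<And>x. GDERIV f x :> G x"
    and lip: "\<And>x y. norm (G y - G x) \<le> L * norm (y - x)"
    and sub: "\<And>x y. f y \<ge> f x + G x \<bullet> (y - x)"
    and "L > 0"
  shows "f y \<ge> f x + G x \<bullet> (y - x) + 1 / (2 * L) * (norm (G y - G x))\<^sup>2"
proof -
  define e where "e = G y - G x"
  define w where "w = y - (1 / L) *\<^sub>R e"
  have "f x + G x \<bullet> (w - x) \<le> f w"
    by (rule sub)
  also have "\<dots> \<le> f y + G y \<bullet> (w - y) + L / 2 * (norm (w - y))\<^sup>2"
    using der lip by (rule smooth_upper_bound)
  finally have "f x + G x \<bullet> (w - x) \<le> f y + G y \<bullet> (w - y) + L / 2 * (norm (w - y))\<^sup>2" .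
  moreover have "G x \<bullet> (w - x) = G x \<bullet> (y - x) - (G x \<bullet> e) / L"
    by (simp add: w_def inner_diff_right)
  moreover have "G y \<bullet> (w - y) = - (G x \<bullet> e) / L - (norm e)\<^sup>2 / L"
    by (simp add: w_def e_def power2_norm_eq_inner inner_diff_left diff_divide_distrib)
  moreover have "L / 2 * (norm (w - y))\<^sup>2 = (norm e)\<^sup>2 / (2 * L)"
    using \<open>L > 0\<close> by (simp add: w_def power_mult_distrib power_divide power2_eq_square)
  ultimately show ?thesis
    by (simp add: e_def field_simps)
qed

lemma strongly_convex_gap:
  fixes g :: "'a::real_inner"
  assumes "fy \<ge> fx + g \<bullet> (y - x) + \<mu> / 2 * (norm (y - x))\<^sup>2" and "\<mu> > 0"
  shows "fx - fy \<le> (norm g)\<^sup>2 / (2 * \<mu>)"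
proof -
  have "0 \<le> (norm (g + \<mu> *\<^sub>R (y - x)))\<^sup>2"
    by simp
  also have "\<dots> = (norm g)\<^sup>2 + 2 * \<mu> * (g \<bullet> (y - x)) + \<mu>\<^sup>2 * (norm (y - x))\<^sup>2"
    by (simp add: power2_norm_eq_inner inner_add_left inner_add_right inner_commute)
       (simp add: power2_eq_square)
  finally have "0 \<le> (norm g)\<^sup>2 + 2 * \<mu> * (g \<bullet> (y - x) + \<mu> / 2 * (norm (y - x))\<^sup>2)"
    by (simp add: power2_eq_square algebra_simps)
  also have "\<dots> \<le> (norm g)\<^sup>2 + 2 * \<mu> * (fy - fx)"
    using assms by (intro add_left_mono mult_left_mono) auto
  finally show ?thesis
    using \<open>\<mu> > 0\<close> by (simp add: field_simps)
qed

lemma minimizer_le: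
  fixes f :: "real ^ 'n \<Rightarrow> real"
  assumes cont: "continuous_on UNIV f" and "\<mu> > 0"
    and sc: "\<And>x y. f y \<ge> f x + G x \<bullet> (y - x) + \<mu> / 2 * (norm (y - x))\<^sup>2"
    and crit: "\<And>x. (\<And>y. f x \<le> f y) \<Longrightarrow> G x = 0"
  shows "f (minimizer f) \<le> f y"
proof -
  define R where "R = 2 * norm (G 0) / \<mu>"
  have "R \<ge> 0"
    using \<open>\<mu> > 0\<close> by (simp add: R_def)
  have far: "f 0 \<le> f y" if "norm y \<ge> R" for y
  proof -
    have "0 \<le> norm y * (\<mu> / 2 * norm y - norm (G 0))"
      using that \<open>\<mu> > 0\<close> by (intro mult_nonneg_nonneg) (auto simp: R_def field_simps)
    moreover have "- (norm (G 0) * norm y) \<le> G 0 \<bullet> y"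
      using norm_cauchy_schwarz[of "- G 0" y] by simp
    ultimately show ?thesis
      using sc[of 0 y] by (simp add: power2_eq_square algebra_simps)
  qed
  have "\<exists>m \<in> cball 0 R. \<forall>y \<in> cball 0 R. f m \<le> f y"
    using \<open>R \<ge> 0\<close> cont by (intro continuous_attains_inf) (auto intro: continuous_on_subset)
  then obtain m where m: "\<forall>y \<in> cball 0 R. f m \<le> f y"
    by blast
  have min: "\<forall>y. f m \<le> f y"
  proof
    fix y
    show "f m \<le> f y"
    proof (cases "norm y \<le> R")
      case False
      moreover have "f m \<le> f 0"
        using m \<open>R \<ge> 0\<close> by simp
      ultimately show ?thesis
        using far[of y] by simp
    qed (use m in simp)
  qed
  have "m' = m" if "\<forall>y. f m' \<le> f y" for m'
  proof -
    have "\<mu> / 2 * (norm (m' - m))\<^sup>2 \<le> 0"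
      using sc[of m m'] crit[of m] min spec[OF that, of m] by simp
    then show ?thesis
      using \<open>\<mu> > 0\<close> by (simp add: mult_le_0_iff)
  qed
  then have "\<forall>y. f (minimizer f) \<le> f y"
    unfolding minimizer_def using min by (rule theI[rotated])
  then show ?thesis ..
qed

lemma norm_convex_step:
  fixes X d g :: "'a::real_inner"
  shows "(norm (p *\<^sub>R (X - b *\<^sub>R g) + (1 - p) *\<^sub>R (X - c *\<^sub>R d)))\<^sup>2
           - (1 - p) * (norm (X - c *\<^sub>R d))\<^sup>2
         = p * (norm X)\<^sup>2 - p * (1 - p) * c\<^sup>2 * (norm d)\<^sup>2 + p\<^sup>2 * b\<^sup>2 * (norm g)\<^sup>2
           - 2 * p * b * (g \<bullet> X) + 2 * p * (1 - p) * b * c * (g \<bullet> d)"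
  unfolding power2_norm_eq_inner
  unfolding inner_add_left inner_add_right inner_diff_left inner_diff_right
    inner_scaleR_left inner_scaleR_right inner_commute[of X g] inner_commute[of d g] inner_commute[of d X]
  by algebra

lemma lyapunov_identity:
  fixes F F' G gd gX XX dd :: real
  assumes "\<mu> > 0" "r > 0" "\<tau> > 0" and s: "s = r\<^sup>2 / \<mu>" and p: "p = \<nu> * r"
    and A: "A = \<zeta> * \<nu> / \<tau>\<^sup>2 * (\<tau> + \<zeta> * \<eta> * r)"
    and I: "I = \<zeta> * \<nu> * (\<tau> + \<zeta> * \<eta> * r) - \<tau>\<^sup>2"
    and II: "II = \<tau> * (\<nu> * \<tau> - 2 * \<zeta> * \<eta>) + \<zeta> * \<eta> * (\<nu> * \<tau> - \<zeta> * \<eta>) * r"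
    and c: "c = \<zeta> / (\<tau> * r)"
  shows "A * (F - \<eta> * s / 2 * G) - (1 - p) * (A * F')
           + \<mu> / 2 * (p * XX - p * (1 - p) * c\<^sup>2 * dd + p\<^sup>2 * (1 / \<mu>)\<^sup>2 * G
             - 2 * p * (1 / \<mu>) * gX + 2 * p * (1 - p) * (1 / \<mu>) * c * gd)
         = p / \<tau>\<^sup>2 * (I * F + r * II * G / (2 * \<mu>))
           - (1 - p) * A * (F' - (F + gd + \<eta> * s / 2 * G))
           - p * (gX - F - \<mu> / 2 * XX)
           - p * (1 - p) * \<zeta>\<^sup>2 / (2 * s * \<tau>\<^sup>2)
             * (dd + 2 * (\<eta> * s) * gd + (\<eta> * s)\<^sup>2 * G)"
proof -
  define K where "K = \<zeta>\<^sup>2 / (2 * s * \<tau>\<^sup>2)"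
  define W where "W = p / \<tau>\<^sup>2 * (r * II / (2 * \<mu>))"
  define h u where "h = \<eta> * s / 2" and "u = \<mu> / 2"
  have h: "\<eta> * s = 2 * h"
    by (simp add: h_def)
  note nz = \<open>\<mu> > 0\<close> \<open>r > 0\<close> \<open>\<tau> > 0\<close>
  have F: "p / \<tau>\<^sup>2 * I = p * (A - 1)"
    unfolding A I using nz by (simp add: field_simps)
  have dd: "\<mu> / 2 * c\<^sup>2 = K"
    unfolding K_def c s using nz by (simp add: field_simps)
  have gd: "p * c = A - 2 * p * K * (\<eta> * s)"
    unfolding K_def c s p A using nz by (simp add: field_simps power2_eq_square)
  have G: "p\<^sup>2 / (2 * \<mu>) = W + (2 - p) * A * (\<eta> * s / 2)
      - p * (1 - p) * K * (\<eta> * s)\<^sup>2"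
    unfolding K_def W_def s p A II using nz
    by (simp add: divide_simps) (simp add: eval_nat_numeral algebra_simps)
  have "A * (F - \<eta> * s / 2 * G) - (1 - p) * (A * F')
           + \<mu> / 2 * (p * XX - p * (1 - p) * c\<^sup>2 * dd + p\<^sup>2 * (1 / \<mu>)\<^sup>2 * G
             - 2 * p * (1 / \<mu>) * gX + 2 * p * (1 - p) * (1 / \<mu>) * c * gd)
      = A * (F - \<eta> * s / 2 * G) - (1 - p) * (A * F') + p * (\<mu> / 2 * XX)
           - p * (1 - p) * (\<mu> / 2 * c\<^sup>2) * dd + p\<^sup>2 / (2 * \<mu>) * G
           - p * gX + (1 - p) * (p * c) * gd"
    using nz by (simp add: field_simps power2_eq_square)
  also have "\<dots> = (p / \<tau>\<^sup>2 * I) * F + W * G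
           - (1 - p) * A * (F' - (F + gd + \<eta> * s / 2 * G))
           - p * (gX - F - \<mu> / 2 * XX)
           - p * (1 - p) * K * (dd + 2 * (\<eta> * s) * gd + (\<eta> * s)\<^sup>2 * G)"
    unfolding F dd gd G
    unfolding h_def[symmetric] u_def[symmetric] unfolding h by algebra
  finally show ?thesis
    by (simp add: K_def W_def algebra_simps)
qed

theorem lemma3:
  fixes f :: "real ^ 'n \<Rightarrow> real"
    and \<mu> L s q \<eta> \<nu> \<tau> \<zeta> I II :: real
    and x y z :: "nat \<Rightarrow> real ^ 'n"
    and V :: "nat \<Rightarrow> real"
  assumes "0 < \<mu>" and "\<mu> \<le> L"
    and "f \<in> smooth_strongly_convex \<mu> L"
    and "s > 0" and "q = \<mu> * s"
    and "0 \<le> \<eta> * s" and "\<eta> * s \<le> 1 / L"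
    and "\<nu> \<ge> 0" and "1 - \<nu> * sqrt q > 0"
    and "\<tau> > 0"
    and "\<zeta> = 1 + (1 - \<tau>) * sqrt q" and "\<zeta> \<ge> 0"
    and "I = \<zeta> * \<nu> * (\<tau> + \<zeta> * \<eta> * sqrt q) - \<tau>\<^sup>2"
    and "II = \<tau> * (\<nu> * \<tau> - 2 * \<zeta> * \<eta>) + \<zeta> * \<eta> * (\<nu> * \<tau> - \<zeta> * \<eta>) * sqrt q"
    and "algorithm_iterates f \<mu> s \<eta> \<nu> \<tau> x y z"
    and "\<forall>k. V (k + 1) =
           \<zeta> * \<nu> / \<tau>\<^sup>2 * (\<tau> + \<zeta> * \<eta> * sqrt q)
             * (f (x k) - f (minimizer f) - \<eta> * s / 2 * (norm (grad f (x k)))\<^sup>2)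
           + \<mu> / 2 * (norm (z (k + 1) - minimizer f))\<^sup>2"
    and "(I > 0 \<and> I + sqrt q * II \<le> 0)
       \<or> (II > 0 \<and> \<mu> / L * I + sqrt q * II \<le> 0)
       \<or> (I \<le> 0 \<and> II \<le> 0)"
  shows "\<forall>k\<ge>1. V (k + 1) \<le> (1 - \<nu> * sqrt q) * V k"
proof (intro allI impI)
  fix k :: nat
  assume "k \<ge> 1"
  then obtain j where k: "k = j + 1"
    by (metis le_add_diff_inverse2)
  have "L > 0"
    using assms(1,2) by simp
  define r where "r = sqrt q"
  have "r > 0" and "r\<^sup>2 = \<mu> * s"
    using assms(1,4,5) by (auto simp: r_def)
  then have s: "s = r\<^sup>2 / \<mu>"
    using assms(1) by simp
  define p where "p = \<nu> * r"
  have p: "0 \<le> p" "0 < 1 - p"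
    using assms(8,9) \<open>r > 0\<close> by (auto simp: p_def r_def)
  have "\<eta> \<ge> 0"
    using assms(4,6) by (simp add: zero_le_mult_iff)
  define A where "A = \<zeta> * \<nu> / \<tau>\<^sup>2 * (\<tau> + \<zeta> * \<eta> * r)"
  have "A \<ge> 0"
    unfolding A_def using assms(8,10,12) \<open>\<eta> \<ge> 0\<close> \<open>r > 0\<close> by simp
  define c where "c = \<zeta> / (\<tau> * r)"

  have fdiff: "f differentiable_on UNIV"
    and lip: "\<And>x y. norm (grad f y - grad f x) \<le> L * norm (y - x)"
    and sc: "\<And>x y. f y \<ge> f x + grad f x \<bullet> (y - x) + \<mu> / 2 * (norm (y - x))\<^sup>2"
    using assms(3) by (auto simp: smooth_strongly_convex_def)
  have der: "GDERIV f x :> grad f x" for x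
    using fdiff by (intro GDERIV_grad) (simp add: differentiable_on_def)
  have sub: "f y \<ge> f x + grad f x \<bullet> (y - x)" for x y
    using sc[of x y] assms(1) by (smt (verit) mult_nonneg_nonneg zero_le_power2 divide_nonneg_pos)
  note coco = cocoercive[OF der lip sub \<open>L > 0\<close>]
  define m where "m = minimizer f"
  have min: "f m \<le> f y" for y
    unfolding m_def using differentiable_imp_continuous_on[OF fdiff] assms(1) sc
    by (rule minimizer_le) (rule GDERIV_global_min[OF der])
  have grad_m: "grad f m = 0"
    using der min by (rule GDERIV_global_min)

  define g where "g = grad f (x k)"
  define g' where "g' = grad f (x j)"
  define d where "d = y k - x k"
  define X where "X = x k - m"
  define F where "F = f (x k) - f m"
  define F' where "F' = f (x j) - f m - \<eta> * s / 2 * (norm g')\<^sup>2"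

  have yk: "y k = x j - (\<eta> * s) *\<^sub>R g'"
    and zk1: "z (k + 1) = p *\<^sub>R (x k - (1 / \<mu>) *\<^sub>R g) + (1 - p) *\<^sub>R z k"
    and xk: "x k = (\<tau> * r / (1 + r)) *\<^sub>R z k + (1 - \<tau> * r / (1 + r)) *\<^sub>R y k"
    using assms(15) unfolding algorithm_iterates_def k g_def g'_def p_def r_def assms(5)
    by (simp_all add: Let_def)
  have "1 - \<tau> * r / (1 + r) = \<zeta> / (1 + r)"
    using \<open>r > 0\<close> unfolding assms(11) r_def[symmetric] by (simp add: field_simps)
  then have "(1 + r) *\<^sub>R x k = (1 + r) *\<^sub>R ((\<tau> * r / (1 + r)) *\<^sub>R z k + (\<zeta> / (1 + r)) *\<^sub>R y k)"
    using xk by simp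
  also have "\<dots> = (\<tau> * r) *\<^sub>R z k + \<zeta> *\<^sub>R y k"
    using \<open>r > 0\<close> by (simp add: scaleR_right_distrib)
  finally have "(\<tau> * r) *\<^sub>R z k = (1 + r) *\<^sub>R x k - \<zeta> *\<^sub>R y k"
    by simp
  also have "\<dots> = (\<tau> * r) *\<^sub>R (x k - c *\<^sub>R d)"
  proof -
    have "1 + r = \<tau> * r + \<zeta>"
      unfolding assms(11) r_def[symmetric] by (simp add: algebra_simps)
    then show ?thesis
      using assms(10) \<open>r > 0\<close> by (simp add: c_def d_def algebra_simps)
  qed
  finally have zk: "z k = x k - c *\<^sub>R d"
    using assms(10) \<open>r > 0\<close> by simp
  then have zm: "z k - m = X - c *\<^sub>R d"
    by (simp add: X_def)
  have z1m: "z (k + 1) - m = p *\<^sub>R (X - (1 / \<mu>) *\<^sub>R g) + (1 - p) *\<^sub>R (X - c *\<^sub>R d)"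
    unfolding zk1 zk by (simp add: X_def algebra_simps)

  have s1: "F' - (F + g \<bullet> d + \<eta> * s / 2 * (norm g)\<^sup>2) \<ge> 0"
  proof -
    have "\<eta> * s / 2 * (norm (g' - g))\<^sup>2 \<le> 1 / (2 * L) * (norm (g' - g))\<^sup>2"
      using assms(7) by (intro mult_right_mono) (auto simp: field_simps)
    then have "f (x j) \<ge> f (x k) + g \<bullet> (x j - x k) + \<eta> * s / 2 * (norm (g' - g))\<^sup>2"
      using coco[of "x k" "x j"] by (simp add: g_def g'_def)
    moreover have "g \<bullet> d = g \<bullet> (x j - x k) - \<eta> * s * (g \<bullet> g')"
      by (simp add: d_def yk inner_diff_right)
    moreover have "(norm (g' - g))\<^sup>2 = (norm g')\<^sup>2 + (norm g)\<^sup>2 - 2 * (g \<bullet> g')"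
      by (simp add: power2_norm_eq_inner inner_simps inner_commute)
    ultimately show ?thesis
      by (simp add: F_def F'_def algebra_simps)
  qed
  have s2: "g \<bullet> X - F - \<mu> / 2 * (norm X)\<^sup>2 \<ge> 0"
    using sc[of "x k" m]
    by (simp add: g_def F_def X_def inner_diff_right norm_minus_commute)
  have s3: "(norm d)\<^sup>2 + 2 * (\<eta> * s) * (g \<bullet> d) + (\<eta> * s)\<^sup>2 * (norm g)\<^sup>2 \<ge> 0"
  proof -
    have "(norm (d + (\<eta> * s) *\<^sub>R g))\<^sup>2
        = (norm d)\<^sup>2 + 2 * (\<eta> * s) * (g \<bullet> d) + (\<eta> * s)\<^sup>2 * (norm g)\<^sup>2"
      unfolding power2_norm_eq_inner
      by (simp add: inner_simps inner_commute) (simp add: power2_eq_square)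
    then show ?thesis
      by (metis zero_le_power2)
  qed

  have F_le: "F \<le> (norm g)\<^sup>2 / (2 * \<mu>)"
    unfolding F_def g_def using sc assms(1) by (rule strongly_convex_gap)
  have le_F: "(norm g)\<^sup>2 \<le> 2 * L * F"
    using coco[of m "x k"] grad_m \<open>L > 0\<close> by (simp add: F_def g_def field_simps)
  have "F \<ge> 0"
    using min by (simp add: F_def)
  have main: "I * F + r * II * (norm g)\<^sup>2 / (2 * \<mu>) \<le> 0"
    using assms(17)
  proof (elim disjE conjE)
    assume h: "I > 0" "I + sqrt q * II \<le> 0"
    have "I * F \<le> I * ((norm g)\<^sup>2 / (2 * \<mu>))"
      using F_le h(1) by (intro mult_left_mono) auto
    moreover have "(I + r * II) * ((norm g)\<^sup>2 / (2 * \<mu>)) \<le> 0"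
      using h(2) assms(1) by (intro mult_nonpos_nonneg) (auto simp: r_def)
    ultimately show ?thesis
      by (simp add: distrib_right add_divide_distrib)
  next
    assume h: "II > 0" "\<mu> / L * I + sqrt q * II \<le> 0"
    have "r * II / (2 * \<mu>) * (norm g)\<^sup>2 \<le> r * II / (2 * \<mu>) * (2 * L * F)"
      using le_F h(1) \<open>r > 0\<close> assms(1) by (intro mult_left_mono) auto
    moreover have "L / \<mu> * F * (\<mu> / L * I + r * II) \<le> 0"
      using h(2) assms(1) \<open>L > 0\<close> \<open>F \<ge> 0\<close> by (intro mult_nonneg_nonpos) (auto simp: r_def)
    moreover have "L / \<mu> * F * (\<mu> / L * I + r * II) = I * F + r * II / (2 * \<mu>) * (2 * L * F)"
      using assms(1) \<open>L > 0\<close> by (simp add: field_simps)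
    ultimately show ?thesis
      by simp
  next
    assume h: "I \<le> 0" "II \<le> 0"
    have "I * F \<le> 0"
      using h(1) \<open>F \<ge> 0\<close> by (rule mult_nonpos_nonneg)
    moreover have "r * II * (norm g)\<^sup>2 / (2 * \<mu>) \<le> 0"
      using h(2) \<open>r > 0\<close> assms(1)
      by (intro divide_nonpos_pos mult_nonpos_nonneg mult_nonneg_nonpos) auto
    ultimately show ?thesis
      by simp
  qed

  have V1: "V (k + 1) = A * (F - \<eta> * s / 2 * (norm g)\<^sup>2) + \<mu> / 2 * (norm (z (k + 1) - m))\<^sup>2"
    using assms(16) by (simp add: A_def F_def g_def m_def r_def)
  have V0: "V k = A * F' + \<mu> / 2 * (norm (z k - m))\<^sup>2"
    using assms(16) by (simp add: A_def F'_def g'_def m_def r_def k)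
  have "V (k + 1) - (1 - p) * V k
      = A * (F - \<eta> * s / 2 * (norm g)\<^sup>2) - (1 - p) * (A * F')
        + \<mu> / 2 * ((norm (z (k + 1) - m))\<^sup>2 - (1 - p) * (norm (z k - m))\<^sup>2)"
    unfolding V1 V0 by (simp add: field_simps)
  also have "\<dots> = p / \<tau>\<^sup>2 * (I * F + r * II * (norm g)\<^sup>2 / (2 * \<mu>))
      - (1 - p) * A * (F' - (F + g \<bullet> d + \<eta> * s / 2 * (norm g)\<^sup>2))
      - p * (g \<bullet> X - F - \<mu> / 2 * (norm X)\<^sup>2)
      - p * (1 - p) * \<zeta>\<^sup>2 / (2 * s * \<tau>\<^sup>2)
        * ((norm d)\<^sup>2 + 2 * (\<eta> * s) * (g \<bullet> d) + (\<eta> * s)\<^sup>2 * (norm g)\<^sup>2)"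
    unfolding z1m zm norm_convex_step
    by (rule lyapunov_identity[OF assms(1) \<open>r > 0\<close> assms(10) s p_def A_def
          assms(13)[folded r_def] assms(14)[folded r_def] c_def])
  also have "\<dots> \<le> 0"
  proof -
    have "p / \<tau>\<^sup>2 * (I * F + r * II * (norm g)\<^sup>2 / (2 * \<mu>)) \<le> 0"
      using main p by (intro mult_nonneg_nonpos) auto
    moreover have "0 \<le> (1 - p) * A * (F' - (F + g \<bullet> d + \<eta> * s / 2 * (norm g)\<^sup>2))"
      using s1 p \<open>A \<ge> 0\<close> by (intro mult_nonneg_nonneg) auto
    moreover have "0 \<le> p * (g \<bullet> X - F - \<mu> / 2 * (norm X)\<^sup>2)"
      using s2 p by (intro mult_nonneg_nonneg) auto
    moreover have "0 \<le> p * (1 - p) * \<zeta>\<^sup>2 / (2 * s * \<tau>\<^sup>2)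
        * ((norm d)\<^sup>2 + 2 * (\<eta> * s) * (g \<bullet> d) + (\<eta> * s)\<^sup>2 * (norm g)\<^sup>2)"
      using s3 p assms(4) by (intro mult_nonneg_nonneg divide_nonneg_nonneg) auto
    ultimately show ?thesis
      by linarith
  qed
  finally show "V (k + 1) \<le> (1 - \<nu> * sqrt q) * V k"
    by (simp add: p_def r_def)
qed

end
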